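(* Let $\mathcal{E}(n)$ (respectively $\mathcal{O}(n)$) denote the number of even (respectively odd) admissible partitions of the positive integer $n$. Then $\mathcal{O}(n) \sim \mathcal{E}(n)$ as $n \to \infty$, i.e. $\lim_{n\to\infty} \mathcal{O}(n)/\mathcal{E}(n) = 1$.
   Context: Let $B$ ("blue") be the set of squarefree positive integers with an even number of prime factors (so $1 \in B$), and $R$ ("red") the set of squarefree positive integers with an odd number of prime factors. A partition of a positive integer $n$ (an unordered representation of $n$ as a sum of positive integers, its parts) is called admissible if every part lies in $B \cup R$ and each element of $R$ appears at most once as a part. An admissible partition is even (respectively odd) if the number of parts belonging to $R$ is even (respectively odd). *)

theory Defs
  imports Complex_Main "HOL-Library.Multiset" "HOL-Computational_Algebra.Computational_Algebra"
begin

definition blue :: "nat set" where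
  "blue = {m. m > 0 \<and> squarefree m \<and> even (card (prime_factors m))}"

definition red :: "nat set" where
  "red = {m. m > 0 \<and> squarefree m \<and> odd (card (prime_factors m))}"

text \<open>A partition is the multiset of its parts.\<close>

definition partitions_of :: "nat \<Rightarrow> nat multiset set" where
  "partitions_of n = {P. (\<forall>m \<in># P. m > 0) \<and> sum_mset P = n}"

definition admissible :: "nat multiset \<Rightarrow> bool" where
  "admissible P \<longleftrightarrow> set_mset P \<subseteq> blue \<union> red \<and> (\<forall>r\<in>red. count P r \<le> 1)"

definition num_red_parts :: "nat multiset \<Rightarrow> nat" where
  "num_red_parts P = size {#m \<in># P. m \<in> red#}"

definition even_partitions :: "nat \<Rightarrow> nat multiset set" where
  "even_partitions n = {P \<in> partitions_of n. admissible P \<and> even (num_red_parts P)}"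

definition odd_partitions :: "nat \<Rightarrow> nat multiset set" where
  "odd_partitions n = {P \<in> partitions_of n. admissible P \<and> odd (num_red_parts P)}"

definition num_even :: "nat \<Rightarrow> nat" where
  "num_even n = card (even_partitions n)"

definition num_odd :: "nat \<Rightarrow> nat" where
  "num_odd n = card (odd_partitions n)"

text \<open>The sets being counted are finite, and the denominator \<^term>\<open>num_even n\<close>
  never vanishes, since \<open>n = 1 + \<dots> + 1\<close> is an even admissible partition.\<close>

lemma finite_partitions_of: "finite (partitions_of n)"
proof -
  have "partitions_of n \<subseteq> mset ` {xs. set xs \<subseteq> {..n} \<and> length xs \<le> n}"
  proof
    fix P assume P: "P \<in> partitions_of n"
    obtain xs where xs: "P = mset xs" using ex_mset by metis
    have pos: "\<forall>m\<in>set xs. m > 0" and s: "sum_list xs = n"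
      using P by (auto simp: partitions_of_def xs sum_mset_sum_list)
    have "length xs \<le> sum_list xs"
      using pos by (induction xs) auto
    moreover have "set xs \<subseteq> {..n}"
      using s member_le_sum_list by auto
    ultimately show "P \<in> mset ` {xs. set xs \<subseteq> {..n} \<and> length xs \<le> n}"
      using s xs by auto
  qed
  then show ?thesis
    by (rule finite_subset) (simp add: finite_lists_length_le)
qed

lemma num_even_pos: "num_even n > 0"
proof -
  have "1 \<in> blue" "1 \<notin> red"
    by (simp_all add: blue_def red_def)
  moreover from this have "num_red_parts (replicate_mset n 1) = 0"
    by (induction n) (auto simp: num_red_parts_def)
  ultimately have "replicate_mset n 1 \<in> even_partitions n"
    by (auto simp: even_partitions_def partitions_of_def admissible_def
        sum_mset_replicate_mset)
  moreover have "finite (even_partitions n)"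
    by (rule finite_subset[OF _ finite_partitions_of[of n]]) (auto simp: even_partitions_def)
  ultimately show ?thesis
    by (auto simp: num_even_def card_gt_0_iff)
qed

end

theory Submission
  imports Defs
begin

text \<open>Trading the red part \<open>2\<close> for two copies of the blue part \<open>1\<close>, or conversely, changes the
  parity of an admissible partition. It cancels all partitions except the \<^emph>\<open>rigid\<close> ones, which do
  not contain \<open>2\<close> and contain at most one \<open>1\<close>, so it suffices that these have density zero.
  In a rigid partition any part \<open>s > 1\<close> can be traded for \<open>s\<close> ones, and the result determines
  the original up to two choices. Hence rigid partitions with more than \<open>K\<close> distinct parts make up a
  fraction at most \<open>2 / K\<close> of all admissible partitions, whereas partitions with at most
  \<open>K + 1\<close> distinct parts are polynomially many and there are superpolynomially many admissible
  partitions, blue being infinite.\<close>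

section \<open>Coloured numbers\<close>

lemma one_blue: "1 \<in> blue" and one_not_red: "1 \<notin> red"
  by (simp_all add: blue_def red_def)

lemma two_red: "2 \<in> red"
proof -
  have "prime_factors (2::nat) = {2}"
    by (simp add: prime_prime_factors)
  then show ?thesis
    by (simp add: red_def squarefree_prime)
qed

lemma double_prime_blue:
  assumes "prime p" "p > 2"
  shows "2 * p \<in> blue"
proof -
  have "prime_factors (2 * p) = {2, p}"
    using assms by (subst prime_factors_product) (auto simp: prime_prime_factors)
  moreover have "coprime 2 p"
    using assms by (intro primes_coprime) auto
  then have "squarefree (2 * p)"
    using assms by (intro squarefree_mult_coprime) (simp_all add: squarefree_prime)
  ultimately show ?thesis
    using assms by (simp add: blue_def)
qed

text \<open>Doubling is injective and sends odd primes to blue numbers, so the infinitude of the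
  primes carries over. This supplies arbitrarily many blue parts for the lower bound on admissible
  partitions.\<close>

lemma infinite_blue: "infinite blue"
proof
  assume "finite blue"
  then have "finite ((*) 2 ` {p::nat. prime p \<and> p > 2})"
    by (rule finite_subset[rotated]) (auto intro: double_prime_blue)
  then have "finite {p::nat. prime p \<and> p > 2}"
    by (rule finite_imageD) (auto simp: inj_on_def)
  then have "finite ({p::nat. prime p \<and> p > 2} \<union> {..2})"
    by simp
  then have "finite {p::nat. prime p}"
    by (rule finite_subset[rotated]) auto
  then show False
    using primes_infinite by simp
qed

section \<open>Cancellation\<close>

definition admissible_partitions :: "nat \<Rightarrow> nat multiset set" where
  "admissible_partitions n = {P \<in> partitions_of n. admissible P}"

definition rigid_partitions :: "nat \<Rightarrow> nat multiset set" where
  "rigid_partitions n = {P \<in> admissible_partitions n. 2 \<notin># P \<and> count P 1 \<le> 1}"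

lemma finite_admissible_partitions: "finite (admissible_partitions n)"
  using finite_partitions_of[of n] by (simp add: admissible_partitions_def)

lemma finite_rigid_partitions: "finite (rigid_partitions n)"
  using finite_admissible_partitions[of n] by (simp add: rigid_partitions_def)

lemma card_admissible_partitions:
  "card (admissible_partitions n) = num_even n + num_odd n"
proof -
  have "admissible_partitions n = even_partitions n \<union> odd_partitions n"
    by (auto simp: admissible_partitions_def even_partitions_def odd_partitions_def)
  moreover have "finite (even_partitions n)" "finite (odd_partitions n)"
    using finite_partitions_of[of n] by (simp_all add: even_partitions_def odd_partitions_def)
  moreover have "even_partitions n \<inter> odd_partitions n = {}"
    by (auto simp: even_partitions_def odd_partitions_def)
  ultimately show ?thesis
    by (simp add: card_Un_disjoint num_even_def num_odd_def)
qed

text \<open>Multiset difference truncates: a rigid partition has neither a \<open>2\<close> nor a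
  pair of ones to give up, and its image has the wrong sum. The map is therefore used on nonrigid
  partitions only.\<close>

definition exchange :: "nat multiset \<Rightarrow> nat multiset" where
  "exchange P = (if 2 \<in># P then P - {#2#} + {#1, 1#} else P - {#1, 1#} + {#2#})"

text \<open>A red \<open>2\<close> occurs at most once, so removing it leaves none. Both forms then
  have the same kind of remainder \<open>Q\<close>, and \<open>exchange\<close> swaps them.\<close>

lemma nonrigid_cases:
  assumes "P \<in> admissible_partitions n - rigid_partitions n"
  obtains Q where "P = Q + {#2#}" "2 \<notin># Q" | Q where "P = Q + {#1, 1#}" "2 \<notin># Q"
proof (cases "2 \<in># P")
  case True
  then obtain Q where Q: "P = add_mset 2 Q"
    by (metis insert_DiffM)
  have "count P 2 \<le> 1"
    using assms two_red by (auto simp: admissible_partitions_def admissible_def)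
  then have "2 \<notin># Q"
    by (simp add: Q not_in_iff)
  then show ?thesis
    using that(1) Q by simp
next
  case False
  then have "count P 1 \<ge> 2"
    using assms by (auto simp: rigid_partitions_def)
  then have "{#1, 1#} \<subseteq># P"
    by (auto simp: subseteq_mset_def)
  then obtain Q where "P = Q + {#1, 1#}"
    by (metis subset_mset.diff_add)
  then show ?thesis
    using that(2) False by simp
qed

lemma exchange_nonrigid:
  assumes "P \<in> admissible_partitions n - rigid_partitions n"
  shows "exchange P \<in> admissible_partitions n - rigid_partitions n"
    and "exchange (exchange P) = P"
    and "even (num_red_parts (exchange P)) \<longleftrightarrow> odd (num_red_parts P)"
proof -
  have "exchange P \<in> admissible_partitions n - rigid_partitions n \<and> exchange (exchange P) = P
    \<and> (even (num_red_parts (exchange P)) \<longleftrightarrow> odd (num_red_parts P))"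
    using assms
  proof (cases rule: nonrigid_cases)
    case (1 Q)
    then have "exchange P = Q + {#1, 1#}" "exchange (exchange P) = P" "count Q 2 = 0"
      by (simp_all add: exchange_def flip: not_in_iff)
    then show ?thesis
      using 1 assms one_blue one_not_red two_red
      by (auto simp: admissible_partitions_def rigid_partitions_def partitions_of_def
          admissible_def num_red_parts_def split: if_splits)
  next
    case (2 Q)
    then have "exchange P = Q + {#2#}" "exchange (exchange P) = P" "count Q 2 = 0"
      by (simp_all add: exchange_def flip: not_in_iff)
    then show ?thesis
      using 2 assms one_blue one_not_red two_red
      by (auto simp: admissible_partitions_def rigid_partitions_def partitions_of_def
          admissible_def num_red_parts_def split: if_splits)
  qed
  then show "exchange P \<in> admissible_partitions n - rigid_partitions n"
    "exchange (exchange P) = P"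
    "even (num_red_parts (exchange P)) \<longleftrightarrow> odd (num_red_parts P)"
    by auto
qed

lemma card_even_odd_nonrigid:
  "card (even_partitions n - rigid_partitions n) = card (odd_partitions n - rigid_partitions n)"
proof (rule bij_betw_same_card)
  define N where "N = admissible_partitions n - rigid_partitions n"
  have even: "even_partitions n - rigid_partitions n = {P \<in> N. even (num_red_parts P)}"
    and odd: "odd_partitions n - rigid_partitions n = {P \<in> N. odd (num_red_parts P)}"
    by (auto simp: N_def even_partitions_def odd_partitions_def admissible_partitions_def)
  show "bij_betw exchange (even_partitions n - rigid_partitions n)
      (odd_partitions n - rigid_partitions n)"
    unfolding even odd
    by (rule bij_betw_byWitness[where f' = exchange])
      (auto simp: exchange_nonrigid[of _ n, folded N_def])
qed

text \<open>The nonrigid partitions cancel in pairs. What remains is a difference of two counts of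
  rigid partitions, each between 0 and their total number.\<close>

lemma num_odd_even_diff_le:
  "\<bar>real (num_odd n) - real (num_even n)\<bar> \<le> real (card (rigid_partitions n))"
proof -
  have split: "card A = card (A \<inter> rigid_partitions n) + card (A - rigid_partitions n)"
    "card (A \<inter> rigid_partitions n) \<le> card (rigid_partitions n)"
    if "finite A" for A
    using that finite_rigid_partitions[of n]
    by (auto simp: card_Int_Diff intro!: card_mono)
  have "finite (even_partitions n)" "finite (odd_partitions n)"
    using finite_partitions_of[of n] by (simp_all add: even_partitions_def odd_partitions_def)
  from split[OF this(1)] split[OF this(2)] show ?thesis
    using card_even_odd_nonrigid[of n] by (simp add: num_even_def num_odd_def)
qed

section \<open>Rigid partitions are rare\<close>

text \<open>Induction on \<open>K\<close>: strip all copies of one element. That element and its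
  multiplicity each have \<open>n + 1\<close> possible values, which costs a factor
  \<open>(n + 1)^2\<close> per distinct element.\<close>

lemma card_multisets_few_distinct:
  fixes n K :: nat
  defines "S \<equiv> \<lambda>K. {P. set_mset P \<subseteq> {..n} \<and> (\<forall>x. count P x \<le> n) \<and> card (set_mset P) \<le> K}"
  shows "finite (S K) \<and> card (S K) \<le> (n + 1) ^ (2 * K)"
proof (induction K)
  case 0
  have "S 0 = {{#}}"
    by (auto simp: S_def)
  then show ?case
    by simp
next
  case (Suc K)
  let ?f = "\<lambda>(P, s, m). P + replicate_mset m s"
  have sub: "S (Suc K) \<subseteq> ?f ` (S K \<times> {..n} \<times> {..n})"
  proof
    fix Q assume Q: "Q \<in> S (Suc K)"
    show "Q \<in> ?f ` (S K \<times> {..n} \<times> {..n})"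
    proof (cases "Q = {#}")
      case True
      then show ?thesis
        \<comment> \<open>There is no element to strip here, so the empty multiset is written as
          itself plus zero copies of 0.\<close>
        by (auto simp: S_def intro!: image_eqI[of _ _ "({#}, 0, 0)"])
    next
      case False
      then obtain s where s: "s \<in># Q"
        by blast
      let ?P = "filter_mset (\<lambda>x. x \<noteq> s) Q"
      have "set_mset ?P = set_mset Q - {s}"
        by auto
      then have "?P \<in> S K"
        using Q s by (auto simp: S_def)
      moreover have "Q = ?P + replicate_mset (count Q s) s"
        by (rule multiset_eqI) auto
      ultimately show ?thesis
        using Q s by (intro image_eqI[of _ _ "(?P, s, count Q s)"]) (auto simp: S_def)
    qed
  qed
  have fin: "finite (S K \<times> {..n} \<times> {..n})"
    using Suc by simp
  have "card (S (Suc K)) \<le> card (S K \<times> {..n} \<times> {..n})"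
    using surj_card_le[OF fin sub] .
  also have "\<dots> \<le> (n + 1) ^ (2 * K) * ((n + 1) * (n + 1))"
    using Suc by (simp add: card_cartesian_product del: mult_Suc mult_Suc_right)
  also have "\<dots> = (n + 1) ^ (2 * Suc K)"
    by (simp add: power_add algebra_simps)
  finally show ?case
    using finite_subset[OF sub] fin by auto
qed

lemma partition_bounds:
  assumes "P \<in> partitions_of n"
  shows "set_mset P \<subseteq> {..n}" "count P x \<le> n"
proof -
  have pos: "\<forall>m\<in>#P. m > 0" and s: "sum_mset P = n"
    using assms by (auto simp: partitions_of_def)
  show "set_mset P \<subseteq> {..n}"
    using s by (auto simp: sum_mset.remove)
  have "size P \<le> sum_mset P"
    using pos by (induction P) auto
  then show "count P x \<le> n"
    using s count_le_size[of P x] by linarith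
qed

lemma card_rigid_few_distinct:
  "card {P \<in> rigid_partitions n. card (set_mset P) \<le> K} \<le> (n + 1) ^ (2 * K)"
proof -
  let ?S = "{P. set_mset P \<subseteq> {..n} \<and> (\<forall>x. count P x \<le> n) \<and> card (set_mset P) \<le> K}"
  have "card {P \<in> rigid_partitions n. card (set_mset P) \<le> K} \<le> card ?S"
    using card_multisets_few_distinct[of n K] partition_bounds[of _ n]
    by (intro card_mono)
      (auto simp: rigid_partitions_def admissible_partitions_def)
  then show ?thesis
    using card_multisets_few_distinct[of n K] by linarith
qed

text \<open>The pairs \<open>(P, s)\<close> are recovered from the traded partition together with the number
  of ones in \<open>P\<close>, which is \<open>0\<close> or \<open>1\<close>.\<close>

lemma sum_distinct_parts_rigid_le:
  "(\<Sum>P\<in>rigid_partitions n. card (set_mset P - {1})) \<le> 2 * card (admissible_partitions n)"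
proof -
  let ?X = "SIGMA P:rigid_partitions n. set_mset P - {1}"
  let ?f = "\<lambda>(P, s). (P - {#s#} + replicate_mset s 1, count P 1)"
  have "inj_on ?f ?X"
  proof (rule inj_onI, unfold split_paired_all)
    fix P s Q t
    assume Ps: "(P, s) \<in> ?X" and Qt: "(Q, t) \<in> ?X" and f: "?f (P, s) = ?f (Q, t)"
    then have s: "s \<in># P" "s \<noteq> 1" and t: "t \<in># Q" "t \<noteq> 1"
      and eq: "P - {#s#} + replicate_mset s 1 = Q - {#t#} + replicate_mset t 1"
      and ones: "count P 1 = count Q 1"
      by auto
    \<comment> \<open>As \<open>s\<close> is not 1, the traded partition has exactly
      \<open>count P 1 + s\<close> ones; with \<open>count P 1\<close> known, this determines
      \<open>s\<close>.\<close>
    from arg_cong[OF eq, of "\<lambda>M. count M 1"] have "s = t"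
      using s t ones by simp
    then have "P - {#s#} = Q - {#s#}"
      using eq by simp
    then show "(P, s) = (Q, t)"
      using s t \<open>s = t\<close> by (metis insert_DiffM)
  qed
  moreover have "?f ` ?X \<subseteq> admissible_partitions n \<times> {..1}"
  proof (rule image_subsetI, unfold split_paired_all)
    fix P s assume Ps: "(P, s) \<in> ?X"
    then have P: "P \<in> rigid_partitions n" and s: "s \<in># P"
      by auto
    let ?Q = "P - {#s#} + replicate_mset s 1"
    have adm: "admissible P" and part: "P \<in> partitions_of n"
      using P by (auto simp: rigid_partitions_def admissible_partitions_def)
    have "sum_mset ?Q = sum_mset P"
      using s by (auto dest!: multi_member_split simp: sum_mset_replicate_mset)
    then have "?Q \<in> partitions_of n"
      using part by (auto simp: partitions_of_def dest: in_diffD)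
    moreover have "count ?Q r \<le> 1" if "r \<in> red" for r
    proof -
      have "count ?Q r \<le> count P r"
        using that one_not_red by auto
      also have "\<dots> \<le> 1"
        using adm that by (auto simp: admissible_def)
      finally show ?thesis .
    qed
    then have "admissible ?Q"
      using adm one_blue unfolding admissible_def by (auto dest!: in_diffD split: if_splits)
    ultimately show "?f (P, s) \<in> admissible_partitions n \<times> {..1}"
      using P by (simp add: admissible_partitions_def rigid_partitions_def)
  qed
  ultimately have "card ?X \<le> card (admissible_partitions n \<times> {..1::nat})"
    using finite_admissible_partitions[of n] by (intro card_inj_on_le) auto
  then show ?thesis
    using finite_rigid_partitions[of n] by (simp add: card_cartesian_product)
qed

text \<open>More than \<open>Suc K\<close> distinct parts leave at least \<open>K\<close> different
  from 1, so each such rigid partition contributes at least \<open>K\<close> to the sum over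
  distinct parts. The others are polynomially few.\<close>

lemma card_rigid_le:
  "K * card (rigid_partitions n)
     \<le> 2 * card (admissible_partitions n) + K * (n + 1) ^ (2 * Suc K)"
proof -
  let ?few = "{P \<in> rigid_partitions n. card (set_mset P) \<le> Suc K}"
  let ?many = "{P \<in> rigid_partitions n. Suc K < card (set_mset P)}"
  have "card (rigid_partitions n) = card (?few \<union> ?many)"
    by (rule arg_cong[where f = card]) auto
  also have "\<dots> \<le> card ?few + card ?many"
    by (rule card_Un_le)
  finally have "K * card (rigid_partitions n) \<le> K * card ?few + K * card ?many"
    by (simp flip: add_mult_distrib2)
  also have "K * card ?many = (\<Sum>P\<in>?many. K)"
    by simp
  also have "\<dots> \<le> (\<Sum>P\<in>?many. card (set_mset P - {1}))"
    by (rule sum_mono) (auto simp: card_Diff_singleton_if)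
  also have "\<dots> \<le> (\<Sum>P\<in>rigid_partitions n. card (set_mset P - {1}))"
    using finite_rigid_partitions by (intro sum_mono2) auto
  also have "\<dots> \<le> 2 * card (admissible_partitions n)"
    by (rule sum_distinct_parts_rigid_le)
  finally show ?thesis
    using mult_le_mono2[OF card_rigid_few_distinct[of n "Suc K"], of K] by linarith
qed

section \<open>Admissible partitions are superpolynomially many\<close>

text \<open>The multiplicities of the elements of \<open>F\<close> are chosen independently up to a
  bound that keeps the sum at most \<open>n\<close>; blue ones fill the rest.\<close>

lemma card_admissible_partitions_ge:
  assumes F: "finite F" "F \<subseteq> blue - {1}"
  shows "(n div (\<Sum>F + 1) + 1) ^ card F \<le> card (admissible_partitions n)"
proof -
  define G :: "(nat \<Rightarrow> nat) \<Rightarrow> nat multiset" where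
    "G = (\<lambda>a. \<Sum>b\<in>F. replicate_mset (a b) b)"
  let ?X = "F \<rightarrow>\<^sub>E {..n div (\<Sum>F + 1)}"
  let ?f = "\<lambda>a. G a + replicate_mset (n - sum_mset (G a)) 1"
  have count_G: "count (G a) b = (if b \<in> F then a b else 0)" for a b
    using F by (simp add: G_def count_sum)
  have set_G: "set_mset (G a) \<subseteq> F" for a
    by (auto simp: count_G simp flip: count_greater_zero_iff split: if_splits)
  have sum_G: "sum_mset (G a) \<le> n" if "a \<in> ?X" for a
  proof -
    have "sum_mset (G a) = (\<Sum>b\<in>F. a b * b)"
      unfolding G_def using F(1) by (induction F rule: finite_induct) (auto simp: sum_mset_replicate_mset)
    also have "\<dots> \<le> (\<Sum>b\<in>F. (n div (\<Sum>F + 1)) * b)"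
      using that by (intro sum_mono mult_right_mono) auto
    also have "\<dots> = n div (\<Sum>F + 1) * \<Sum>F"
      by (simp add: sum_distrib_left)
    also have "\<dots> \<le> n div (\<Sum>F + 1) * (\<Sum>F + 1)"
      by simp
    also have "\<dots> \<le> n"
      by (rule div_times_less_eq_dividend)
    finally show ?thesis .
  qed
  have "inj_on ?f ?X"
  proof (rule inj_onI)
    fix a a' assume a: "a \<in> ?X" "a' \<in> ?X" and eq: "?f a = ?f a'"
    show "a = a'"
    proof (rule PiE_ext[OF a])
      fix b assume b: "b \<in> F"
      \<comment> \<open>The filling ones leave the multiplicities on \<open>F\<close> untouched, so
        these can be read off from the partition.\<close>
      then have "b \<noteq> 1"
        using F by auto
      then show "a b = a' b"
        using arg_cong[OF eq, of "\<lambda>M. count M b"] b by (simp add: count_G)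
    qed
  qed
  moreover have "?f ` ?X \<subseteq> admissible_partitions n"
  proof clarify
    fix a assume a: "a \<in> ?X"
    have parts: "set_mset (?f a) \<subseteq> blue"
      using set_G[of a] F(2) one_blue by auto
    then have "\<forall>m\<in>#?f a. m > 0"
      by (auto simp: blue_def)
    then have "?f a \<in> partitions_of n"
      using sum_G[OF a] by (simp add: partitions_of_def sum_mset_replicate_mset)
    moreover have "r \<notin># ?f a" if "r \<in> red" for r
      using that parts by (auto simp: blue_def red_def)
    then have "admissible (?f a)"
      using parts unfolding admissible_def by (metis le_supI1 not_in_iff zero_le)
    ultimately show "?f a \<in> admissible_partitions n"
      by (simp add: admissible_partitions_def)
  qed
  ultimately have "card ?X \<le> card (admissible_partitions n)"
    using finite_admissible_partitions by (intro card_inj_on_le)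
  then show ?thesis
    using F by (simp add: card_PiE)
qed

lemma admissible_partitions_superpolynomial:
  obtains C :: real where "C > 0" "\<And>n. real n ^ M \<le> C * real (card (admissible_partitions n))"
proof -
  have "infinite (blue - {1})"
    using infinite_blue by simp
  then obtain F where F: "F \<subseteq> blue - {1}" "finite F" "card F = M"
    by (meson infinite_arbitrarily_large)
  \<comment> \<open>The summand 1 keeps \<open>c\<close> positive even when \<open>F\<close> is
    empty.\<close>
  define c where "c = \<Sum>F + 1"
  have "real n ^ M \<le> real c ^ M * real (card (admissible_partitions n))" for n
  proof -
    have "n \<le> c * (n div c + 1)"
      using dividend_less_times_div[of c n] by (simp add: c_def)
    then have "n ^ M \<le> c ^ M * (n div c + 1) ^ M"
      by (metis power_mono power_mult_distrib zero_le)
    also have "\<dots> \<le> c ^ M * card (admissible_partitions n)"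
      using card_admissible_partitions_ge[OF F(2,1), of n] F(3) by (simp add: c_def)
    finally show ?thesis
      by (metis of_nat_le_iff of_nat_mult of_nat_power)
  qed
  moreover have "c > 0"
    by (simp add: c_def)
  then have "real c ^ M > 0"
    by simp
  ultimately show ?thesis
    using that by blast
qed

section \<open>Asymptotics\<close>

lemma rigid_density_zero:
  "(\<lambda>n. real (card (rigid_partitions n)) / real (card (admissible_partitions n))) \<longlonglongrightarrow> 0"
proof (rule LIMSEQ_I)
  fix e :: real assume e: "e > 0"
  \<comment> \<open>This choice makes \<open>2 / K\<close> less than \<open>e / 2\<close>; the other
    half of \<open>e\<close> is kept for the polynomial term.\<close>
  obtain K :: nat where K: "real K > 4 / e"
    using reals_Archimedean2 by blast
  then have K0: "real K > 0"
    using e by (metis divide_pos_pos less_trans zero_less_numeral)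
  \<comment> \<open>The exponent is one more than the degree \<open>2 * Suc K\<close> of the
    polynomial term, so that term is at most \<open>D / n\<close> times the number of admissible
    partitions. The power of 2 in \<open>D\<close> comes from
    \<open>n + 1 \<le> 2 * n\<close>.\<close>
  obtain C where C: "C > 0"
    and lower: "\<And>n. real n ^ (2 * Suc K + 1) \<le> C * real (card (admissible_partitions n))"
    using admissible_partitions_superpolynomial by blast
  define D where "D = C * 2 ^ (2 * Suc K)"
  obtain N :: nat where N: "real N > 2 * D / e"
    using reals_Archimedean2 by blast
  have "real (card (rigid_partitions n)) / real (card (admissible_partitions n)) < e"
    if n: "n \<ge> Suc N" for n
  proof -
    define T where "T = real (card (admissible_partitions n))"
    define r where "r = real (card (rigid_partitions n))"
    have "real n > 2 * D / e" and n0: "real n > 0"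
      using n N by linarith+
    then have D: "D / real n < e / 2"
      using e by (simp add: field_simps)
    have T: "T > 0"
      using num_even_pos[of n] by (simp add: T_def card_admissible_partitions)
    have "real (n + 1) ^ (2 * Suc K) \<le> (2 * real n) ^ (2 * Suc K)"
      using n by (intro power_mono) auto
    also have "\<dots> = 2 ^ (2 * Suc K) * (real n ^ (2 * Suc K + 1) / real n)"
      using n0 by (simp add: power_mult_distrib)
    also have "\<dots> \<le> 2 ^ (2 * Suc K) * (C * T / real n)"
      using lower[of n] n0 by (intro mult_left_mono divide_right_mono) (auto simp: T_def)
    also have "\<dots> = D / real n * T"
      by (simp add: D_def)
    finally have poly: "real (n + 1) ^ (2 * Suc K) \<le> D / real n * T" .
    have "real (K * card (rigid_partitions n))
        \<le> real (2 * card (admissible_partitions n) + K * (n + 1) ^ (2 * Suc K))"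
      using card_rigid_le by (rule of_nat_mono)
    then have "real K * r \<le> 2 * T + real K * real (n + 1) ^ (2 * Suc K)"
      by (simp only: T_def r_def of_nat_add of_nat_mult of_nat_power of_nat_numeral)
    then have "r \<le> 2 / real K * T + real (n + 1) ^ (2 * Suc K)"
      using K0 by (simp add: field_simps del: power_Suc mult_Suc_right of_nat_add of_nat_Suc)
    also have "\<dots> \<le> (2 / real K + D / real n) * T"
      using poly unfolding distrib_right by (rule add_left_mono)
    also have "\<dots> < e * T"
    proof (rule mult_strict_right_mono[OF _ T])
      have "2 / real K < e / 2"
        using K K0 e by (simp add: field_simps)
      then show "2 / real K + D / real n < e"
        using D by linarith
    qed
    finally show ?thesis
      using T by (simp add: T_def r_def field_simps)
  qed
  then show "\<exists>N. \<forall>n\<ge>N. norm (real (card (rigid_partitions n))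
      / real (card (admissible_partitions n)) - 0) < e"
    by (intro exI[of _ "Suc N"]) simp
qed

theorem theorem1p1:
  shows "(\<lambda>n. real (num_odd n) / real (num_even n)) \<longlonglongrightarrow> 1"
proof -
  define q where
    "q = (\<lambda>n. real (card (rigid_partitions n)) / real (card (admissible_partitions n)))"
  have q: "q \<longlonglongrightarrow> 0"
    using rigid_density_zero by (simp add: q_def)
  \<comment> \<open>The bound is relative to all admissible partitions, but the limit divides by the
    even ones. Once fewer than half are rigid, the total is at most 4 times the even count, whence
    the factor 4.\<close>
  have "eventually (\<lambda>n. q n < 1 / 2) sequentially"
    using q by (rule order_tendstoD) simp
  then have "eventually (\<lambda>n. norm (real (num_odd n) / real (num_even n) - 1) \<le> norm (q n) * 4) sequentially"
  proof eventually_elim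
    case (elim n)
    define E O' r where "E = real (num_even n)" and "O' = real (num_odd n)"
      and "r = real (card (rigid_partitions n))"
    have E: "E > 0" and O': "O' \<ge> 0"
      using num_even_pos[of n] by (simp_all add: E_def O'_def)
    have qn: "q n = r / (E + O')"
      by (simp add: q_def r_def E_def O'_def card_admissible_partitions)
    have diff: "\<bar>O' - E\<bar> \<le> r"
      using num_odd_even_diff_le[of n] by (simp add: E_def O'_def r_def)
    have "r < (E + O') / 2"
      using elim E O' by (simp add: qn field_simps)
    then have "E + O' \<le> 4 * E"
      using abs_le_D1[OF diff] by (simp add: field_simps)
    have "norm (O' / E - 1) = \<bar>O' - E\<bar> / E"
      using E by (simp add: field_simps abs_divide flip: abs_of_pos)
    also have "\<dots> \<le> r / E"
      using diff E by (simp add: divide_right_mono)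
    also have "\<dots> = 4 * (r / (4 * E))"
      by simp
    also have "\<dots> \<le> 4 * q n"
      unfolding qn using \<open>E + O' \<le> 4 * E\<close> E O' diff by (intro mult_left_mono divide_left_mono) auto
    also have "\<dots> \<le> norm (q n) * 4"
      by simp
    finally show ?case
      by (simp add: E_def O'_def)
  qed
  with q have "(\<lambda>n. real (num_odd n) / real (num_even n) - 1) \<longlonglongrightarrow> 0"
    by (rule tendsto_0_le)
  then show ?thesis
    by (simp add: LIM_zero_iff)
qed

end
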